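(* Let $W\in\mathbb{R}^{N\times M}$ with $N=I_1\cdots I_n$ and $M=J_1\cdots J_m$, where all $I_k,J_k$ are positive integers, and set $I=\max_k I_k$, $J=\max_k J_k$. (MPS) Suppose $W$ is given by the cores $A^{(1)},\dots,A^{(n)},B^{(1)},\dots,B^{(m)}$ of an MPS tensor train, and let $R$ be the maximum of its inner ranks. Then the storage required is of order $$O\bigl(R(I+J)+R^2[(n-1)I+(m-1)J]\bigr),$$ and the number of operations required to compute $Wx$ for a vector $x\in\mathbb{R}^M$ is of order $$O_{\mathrm{MPS}}=O\bigl(R(N+M)+R^2[(n-1)N+(m-1)M]\bigr).$$ (MPO) Suppose $m=n\ge 2$ and $W$ is given by the cores $A^{(1)},\dots,A^{(n)}$ of an MPO tensor train, and let $R$ be the maximum of its inner ranks. Then the storage required is of order $$O\bigl(IJ[2R+(n-2)R^2]\bigr),$$ and computing $Wx$ for $x\in\mathbb{R}^M$ by reconstructing the weight matrix $W$ from the cores and then multiplying requires a number of operations of order $$O_{\mathrm{MPO}}=O\bigl(NM[R+R^2(n-2)]\bigr).$$ The implied constants are absolute (independent of $n,m$, the dimensions and the ranks).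
   Context: Rows $i\in\{1,\dots,N\}$ of $W$ are identified with multi-indices $(i_1,\dots,i_n)$, $1\le i_k\le I_k$, via $i=i_n+(i_{n-1}-1)I_n+\cdots+(i_1-1)I_2\cdots I_n$. Columns $j\in\{1,\dots,M\}$ are identified with $(j_1,\dots,j_m)$, $1\le j_k\le J_k$, in the same way (with $J$ in place of $I$). The vector $x$ is indexed by $(j_1,\dots,j_m)$ accordingly. MPS (matrix product state) tensor train: core tensors $A^{(k)}\in\mathbb{R}^{r_{r(k-1)}\times I_k\times r_{rk}}$ ($k=1,\dots,n$) and $B^{(k)}\in\mathbb{R}^{r_{c(k-1)}\times J_k\times r_{ck}}$ ($k=1,\dots,m$), with positive integer inner ranks satisfying $r_{r0}=r_{cm}=1$ and $r_{rn}=r_{c0}$, such that $$W(i_1,\dots,i_n,j_1,\dots,j_m)=\sum A^{(1)}_{(1,i_1,k_1)}A^{(2)}_{(k_1,i_2,k_2)}\cdots A^{(n)}_{(k_{n-1},i_n,h_0)}B^{(1)}_{(h_0,j_1,h_1)}\cdots B^{(m)}_{(h_{m-1},j_m,1)},$$ the sum being over all internal indices $k_1,\dots,k_{n-1},h_0,\dots,h_{m-1}$. Here $R=\max\{r_{r0},\dots,r_{rn},r_{c0},\dots,r_{cm}\}$. MPO (matrix product operator) tensor train, for $m=n$: core tensors $A^{(k)}\in\mathbb{R}^{r_{k-1}\times I_kJ_k\times r_k}$, $k=1,\dots,n$, with positive integer inner ranks, $r_0=r_n=1$, such that, with $h_k=i_k+(j_k-1)I_k$, $$W(i_1,\dots,i_n,j_1,\dots,j_n)=\sum_{k_1,\dots,k_{n-1}}A^{(1)}_{(1,h_1,k_1)}A^{(2)}_{(k_1,h_2,k_2)}\cdots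 A^{(n)}_{(k_{n-1},h_n,1)}.$$ Here $R=\max\{r_0,\dots,r_n\}$. Storage is the total number of entries of the core tensors. The number of operations is the number of scalar additions and multiplications. A bound on the number of operations "required" means that the result can be computed from the cores within that number of operations. *)

theory Defs
  imports Complex_Main "HOL-Library.FuncSet" "Jordan_Normal_Form.Matrix"
begin

section \<open>Multi-indices\<close>

text \<open>
  A family of dimensions is a function \<open>I\<close> of which only \<open>I 1, \<dots>, I n\<close> matter. Multi-indices are
  1-based; the position \<open>flat_index n I i\<close> is 1-based too, whereas the library's matrices and
  vectors are 0-based, so that position \<open>p\<close> is row (or column) \<open>p - 1\<close> there.
\<close>

definition dim_prod :: "nat \<Rightarrow> (nat \<Rightarrow> nat) \<Rightarrow> nat" where
  "dim_prod n I = (\<Prod>k = 1..n. I k)"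

definition dim_max :: "nat \<Rightarrow> (nat \<Rightarrow> nat) \<Rightarrow> nat" where
  "dim_max n I = Max (I ` {1..n})"

definition multi_indices :: "nat \<Rightarrow> (nat \<Rightarrow> nat) \<Rightarrow> (nat \<Rightarrow> nat) set" where
  "multi_indices n I = (\<Pi>\<^sub>E k\<in>{1..n}. {1..I k})"

definition flat_index :: "nat \<Rightarrow> (nat \<Rightarrow> nat) \<Rightarrow> (nat \<Rightarrow> nat) \<Rightarrow> nat" where
  "flat_index n I i = i n + (\<Sum>k = 1..<n. (i k - 1) * (\<Prod>l = k+1..n. I l))"


section \<open>Tensor trains\<close>

text \<open>
  The entry \<open>(a, i, b)\<close> of the \<open>k\<close>-th core is labelled \<open>(k, a, i, b)\<close>. A family of cores is a
  real function on labels; its values outside \<open>core_entries\<close> are irrelevant.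
\<close>

type_synonym label = "nat \<times> nat \<times> nat \<times> nat"

definition core_entries :: "nat \<Rightarrow> (nat \<Rightarrow> nat) \<Rightarrow> (nat \<Rightarrow> nat) \<Rightarrow> label set" where
  "core_entries n I r = (SIGMA k : {1..n}. {1..r (k - 1)} \<times> {1..I k} \<times> {1..r k})"

definition mps_shape ::
    "nat \<Rightarrow> nat \<Rightarrow> (nat \<Rightarrow> nat) \<Rightarrow> (nat \<Rightarrow> nat) \<Rightarrow> (nat \<Rightarrow> nat) \<Rightarrow> (nat \<Rightarrow> nat) \<Rightarrow> bool" where
  "mps_shape n m I J r c \<longleftrightarrow>
     1 \<le> n \<and> 1 \<le> m \<and>
     (\<forall>k\<in>{1..n}. 0 < I k) \<and> (\<forall>k\<in>{1..m}. 0 < J k) \<and>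
     (\<forall>k\<in>{0..n}. 0 < r k) \<and> (\<forall>k\<in>{0..m}. 0 < c k) \<and>
     r 0 = 1 \<and> c m = 1 \<and> r n = c 0"

definition mps_entries ::
    "nat \<Rightarrow> nat \<Rightarrow> (nat \<Rightarrow> nat) \<Rightarrow> (nat \<Rightarrow> nat) \<Rightarrow> (nat \<Rightarrow> nat) \<Rightarrow> (nat \<Rightarrow> nat) \<Rightarrow> (label + label) set"
  where "mps_entries n m I J r c = core_entries n I r <+> core_entries m J c"

definition mps_rank :: "nat \<Rightarrow> nat \<Rightarrow> (nat \<Rightarrow> nat) \<Rightarrow> (nat \<Rightarrow> nat) \<Rightarrow> nat" where
  "mps_rank n m r c = Max (r ` {0..n} \<union> c ` {0..m})"

text \<open>
  The internal indices are \<open>\<kappa> 1, \<dots>, \<kappa> (n - 1)\<close> and \<open>h 0, \<dots>, h (m - 1)\<close>. The outer indices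
  \<open>\<kappa> 0\<close> and \<open>h m\<close> are forced to be 1, since \<open>r 0 = c m = 1\<close>, and \<open>\<kappa> n\<close> is identified with \<open>h 0\<close>.
\<close>

definition is_mps ::
    "nat \<Rightarrow> nat \<Rightarrow> (nat \<Rightarrow> nat) \<Rightarrow> (nat \<Rightarrow> nat) \<Rightarrow> (nat \<Rightarrow> nat) \<Rightarrow> (nat \<Rightarrow> nat) \<Rightarrow>
     (label \<Rightarrow> real) \<Rightarrow> (label \<Rightarrow> real) \<Rightarrow> real mat \<Rightarrow> bool" where
  "is_mps n m I J r c A B W \<longleftrightarrow>
     W \<in> carrier_mat (dim_prod n I) (dim_prod m J) \<and>
     (\<forall>i\<in>multi_indices n I. \<forall>j\<in>multi_indices m J.
        W $$ (flat_index n I i - 1, flat_index m J j - 1) =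
        (\<Sum>h\<in>(\<Pi>\<^sub>E k\<in>{0..m}. {1..c k}).
         \<Sum>\<kappa>\<in>{\<kappa> \<in> (\<Pi>\<^sub>E k\<in>{0..n}. {1..r k}). \<kappa> n = h 0}.
           (\<Prod>k = 1..n. A (k, \<kappa> (k - 1), i k, \<kappa> k)) *
           (\<Prod>k = 1..m. B (k, h (k - 1), j k, h k))))"

definition mpo_shape :: "nat \<Rightarrow> (nat \<Rightarrow> nat) \<Rightarrow> (nat \<Rightarrow> nat) \<Rightarrow> (nat \<Rightarrow> nat) \<Rightarrow> bool" where
  "mpo_shape n I J r \<longleftrightarrow>
     2 \<le> n \<and>
     (\<forall>k\<in>{1..n}. 0 < I k) \<and> (\<forall>k\<in>{1..n}. 0 < J k) \<and>
     (\<forall>k\<in>{0..n}. 0 < r k) \<and> r 0 = 1 \<and> r n = 1"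

definition mpo_entries ::
    "nat \<Rightarrow> (nat \<Rightarrow> nat) \<Rightarrow> (nat \<Rightarrow> nat) \<Rightarrow> (nat \<Rightarrow> nat) \<Rightarrow> label set" where
  "mpo_entries n I J r = core_entries n (\<lambda>k. I k * J k) r"

definition mpo_rank :: "nat \<Rightarrow> (nat \<Rightarrow> nat) \<Rightarrow> nat" where
  "mpo_rank n r = Max (r ` {0..n})"

text \<open>Again \<open>r 0 = r n = 1\<close> forces the outer indices \<open>\<kappa> 0\<close> and \<open>\<kappa> n\<close> to be 1.\<close>

definition is_mpo ::
    "nat \<Rightarrow> (nat \<Rightarrow> nat) \<Rightarrow> (nat \<Rightarrow> nat) \<Rightarrow> (nat \<Rightarrow> nat) \<Rightarrow> (label \<Rightarrow> real) \<Rightarrow> real mat \<Rightarrow> bool" where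
  "is_mpo n I J r A W \<longleftrightarrow>
     W \<in> carrier_mat (dim_prod n I) (dim_prod n J) \<and>
     (\<forall>i\<in>multi_indices n I. \<forall>j\<in>multi_indices n J.
        W $$ (flat_index n I i - 1, flat_index n J j - 1) =
        (\<Sum>\<kappa>\<in>(\<Pi>\<^sub>E k\<in>{0..n}. {1..r k}).
           \<Prod>k = 1..n. A (k, \<kappa> (k - 1), i k + (j k - 1) * I k, \<kappa> k)))"


section \<open>Counting operations\<close>

text \<open>
  Operations are counted in straight-line programs. An instruction is one scalar addition or
  multiplication, applied to inputs (identified by labels of type \<open>'v\<close>) or to results of earlier
  instructions, so the length of a program is its number of operations. There are no free constants,
  and a program cannot depend on the values of its inputs.
\<close>

datatype 'v operand = Input 'v | Result nat

datatype 'v instr = Add "'v operand" "'v operand" | Mul "'v operand" "'v operand"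

fun operand_val :: "('v \<Rightarrow> real) \<Rightarrow> real list \<Rightarrow> 'v operand \<Rightarrow> real" where
  "operand_val \<rho> vs (Input v) = \<rho> v"
| "operand_val \<rho> vs (Result t) = vs ! t"

fun instr_val :: "('v \<Rightarrow> real) \<Rightarrow> real list \<Rightarrow> 'v instr \<Rightarrow> real" where
  "instr_val \<rho> vs (Add a b) = operand_val \<rho> vs a + operand_val \<rho> vs b"
| "instr_val \<rho> vs (Mul a b) = operand_val \<rho> vs a * operand_val \<rho> vs b"

definition results :: "('v \<Rightarrow> real) \<Rightarrow> 'v instr list \<Rightarrow> real list" where
  "results \<rho> p = foldl (\<lambda>vs e. vs @ [instr_val \<rho> vs e]) [] p"

fun operand_ok :: "'v set \<Rightarrow> nat \<Rightarrow> 'v operand \<Rightarrow> bool" where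
  "operand_ok V t (Input v) \<longleftrightarrow> v \<in> V"
| "operand_ok V t (Result s) \<longleftrightarrow> s < t"

fun instr_ok :: "'v set \<Rightarrow> nat \<Rightarrow> 'v instr \<Rightarrow> bool" where
  "instr_ok V t (Add a b) \<longleftrightarrow> operand_ok V t a \<and> operand_ok V t b"
| "instr_ok V t (Mul a b) \<longleftrightarrow> operand_ok V t a \<and> operand_ok V t b"

text \<open>
  \<open>p\<close> reads only inputs in \<open>V\<close>, and \<open>out\<close> selects, for each output label in \<open>U\<close>, an input or an
  intermediate result.
\<close>

definition is_program :: "'v set \<Rightarrow> 'u set \<Rightarrow> 'v instr list \<Rightarrow> ('u \<Rightarrow> 'v operand) \<Rightarrow> bool" where
  "is_program V U p out \<longleftrightarrow>
     (\<forall>t<length p. instr_ok V t (p ! t)) \<and> (\<forall>u\<in>U. operand_ok V (length p) (out u))"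

definition output_val :: "('v \<Rightarrow> real) \<Rightarrow> 'v instr list \<Rightarrow> ('u \<Rightarrow> 'v operand) \<Rightarrow> 'u \<Rightarrow> real" where
  "output_val \<rho> p out u = operand_val \<rho> (results \<rho> p) (out u)"

text \<open>\<open>W x\<close> is computed from the cores of an MPS tensor train and from \<open>x\<close>.\<close>

definition mps_matvec_program ::
    "nat \<Rightarrow> nat \<Rightarrow> (nat \<Rightarrow> nat) \<Rightarrow> (nat \<Rightarrow> nat) \<Rightarrow> (nat \<Rightarrow> nat) \<Rightarrow> (nat \<Rightarrow> nat) \<Rightarrow>
     ((label + label) + nat) instr list \<Rightarrow> (nat \<Rightarrow> ((label + label) + nat) operand) \<Rightarrow> bool" where
  "mps_matvec_program n m I J r c p out \<longleftrightarrow>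
     is_program (mps_entries n m I J r c <+> {..<dim_prod m J}) {..<dim_prod n I} p out \<and>
     (\<forall>A B W x. is_mps n m I J r c A B W \<longrightarrow> x \<in> carrier_vec (dim_prod m J) \<longrightarrow>
        vec (dim_prod n I) (output_val (case_sum (case_sum A B) (($) x)) p out) = W *\<^sub>v x)"

text \<open>All entries of \<open>W\<close> are computed from the cores of an MPO tensor train.\<close>

definition mpo_reconstruct_program ::
    "nat \<Rightarrow> (nat \<Rightarrow> nat) \<Rightarrow> (nat \<Rightarrow> nat) \<Rightarrow> (nat \<Rightarrow> nat) \<Rightarrow>
     label instr list \<Rightarrow> (nat \<times> nat \<Rightarrow> label operand) \<Rightarrow> bool" where
  "mpo_reconstruct_program n I J r p out \<longleftrightarrow>
     is_program (mpo_entries n I J r) ({..<dim_prod n I} \<times> {..<dim_prod n J}) p out \<and>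
     (\<forall>A W. is_mpo n I J r A W \<longrightarrow>
        mat (dim_prod n I) (dim_prod n J) (output_val A p out) = W)"

text \<open>\<open>W x\<close> is computed from the entries of an arbitrary \<open>N \<times> M\<close> matrix \<open>W\<close> and from \<open>x\<close>.\<close>

definition matvec_program ::
    "nat \<Rightarrow> nat \<Rightarrow> ((nat \<times> nat) + nat) instr list \<Rightarrow> (nat \<Rightarrow> ((nat \<times> nat) + nat) operand) \<Rightarrow> bool"
  where
  "matvec_program N M p out \<longleftrightarrow>
     is_program (({..<N} \<times> {..<M}) <+> {..<M}) {..<N} p out \<and>
     (\<forall>W x. W \<in> carrier_mat N M \<longrightarrow> x \<in> carrier_vec M \<longrightarrow>
        vec N (output_val (case_sum (($$) W) (($) x)) p out) = W *\<^sub>v x)"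

end

theory Submission
  imports Defs
begin

text \<open>
  For fixed multi-indices an entry of a tensor train is a product of matrices of sizes
  \<open>r\<^sub>k\<^sub>-\<^sub>1 \<times> r\<^sub>k\<close> with outer dimension 1, so multiplying it with a vector from the right costs at most
  \<open>2 \<Sum>\<^sub>k r\<^sub>k\<^sub>-\<^sub>1 r\<^sub>k\<close> operations. One outer rank being 1, this sum is at most \<open>R + (n - 1) R\<^sup>2\<close>.
  In the MPS case, for every column \<open>j\<close> the \<open>B\<close>-train applied to \<open>x\<^sub>j\<close> gives a vector of
  length \<open>c\<^sub>0\<close>; these \<open>M\<close> vectors are added up, and the \<open>A\<close>-train of every row is applied to their
  sum. No intermediate results have to be shared between different rows or different columns. In the
  MPO case the last core is itself a column vector, so that only \<open>n - 1\<close> products remain per entry.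
\<close>

section \<open>Positions of multi-indices\<close>

text \<open>Horner's rule for a mixed-radix expansion whose least significant digit is the last
  index. With \<open>1 \<le> i n\<close> the truncated differences \<open>i n - 1\<close> and
  \<open>flat_index n I i - 1\<close> are genuine.\<close>

lemma flat_index_Suc:
  assumes "1 \<le> n" "1 \<le> i n"
  shows "flat_index (Suc n) I i = (flat_index n I i - 1) * I (Suc n) + i (Suc n)"
proof -
  obtain m where n: "n = Suc m" using assms(1) by (cases n) auto
  have split: "(\<Prod>l = k+1..Suc n. I l) = (\<Prod>l = k+1..n. I l) * I (Suc n)" if "k \<le> n" for k
    using that by (simp add: prod.nat_ivl_Suc')
  have "(\<Sum>k = 1..<Suc n. (i k - 1) * (\<Prod>l = k+1..Suc n. I l)) =
        (\<Sum>k = 1..<Suc n. (i k - 1) * (\<Prod>l = k+1..n. I l)) * I (Suc n)"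
    unfolding sum_distrib_right by (rule sum.cong) (use split in auto)
  also have "(\<Sum>k = 1..<Suc n. (i k - 1) * (\<Prod>l = k+1..n. I l)) = flat_index n I i - 1"
    using assms by (simp add: flat_index_def)
  finally show ?thesis unfolding flat_index_def[of "Suc n"] by simp
qed

lemma dim_prod_Suc: "dim_prod (Suc n) I = dim_prod n I * I (Suc n)"
  by (simp add: dim_prod_def)

lemma card_multi_indices: "card (multi_indices n I) = dim_prod n I"
  by (simp add: multi_indices_def dim_prod_def card_PiE)

lemma finite_multi_indices: "finite (multi_indices n I)"
  by (auto simp: multi_indices_def intro: finite_PiE)

lemma multi_indices_bounds:
  "i \<in> multi_indices n I \<Longrightarrow> k \<in> {1..n} \<Longrightarrow> 1 \<le> i k \<and> i k \<le> I k"
  by (fastforce simp: multi_indices_def)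

text \<open>Quotient and remainder by \<open>I (Suc n)\<close> split a position into a shorter
  position, covered by the induction hypothesis, and its last digit.\<close>

lemma flat_index_image:
  assumes "1 \<le> n"
  shows "(\<lambda>i. flat_index n I i - 1) ` multi_indices n I = {..<dim_prod n I}"
  using assms
proof (induction n rule: nat_induct_at_least)
  case base
  show ?case
  proof (intro equalityI subsetI)
    fix p assume "p \<in> (\<lambda>i. flat_index 1 I i - 1) ` multi_indices 1 I"
    then obtain i where i: "i \<in> multi_indices 1 I" "p = flat_index 1 I i - 1" by blast
    then show "p \<in> {..<dim_prod 1 I}"
      using multi_indices_bounds[OF i(1), of 1] by (auto simp: flat_index_def dim_prod_def)
  next
    fix p assume p: "p \<in> {..<dim_prod 1 I}"
    show "p \<in> (\<lambda>i. flat_index 1 I i - 1) ` multi_indices 1 I"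
      by (rule image_eqI[where x = "\<lambda>k\<in>{1}. Suc p"])
        (use p in \<open>auto simp: flat_index_def dim_prod_def multi_indices_def\<close>)
  qed
next
  case (Suc n)
  show ?case
  proof (intro equalityI subsetI)
    fix p assume "p \<in> (\<lambda>i. flat_index (Suc n) I i - 1) ` multi_indices (Suc n) I"
    then obtain i where i: "i \<in> multi_indices (Suc n) I" "p = flat_index (Suc n) I i - 1" by blast
    \<comment> \<open>Multi-indices are extensional functions, so the last index has to be erased
      before the induction hypothesis applies; \<open>flat_index n\<close> does not read it.\<close>
    let ?i = "restrict i {1..n}"
    have "?i \<in> multi_indices n I" using i(1) by (auto simp: multi_indices_def)
    moreover have "flat_index n I ?i = flat_index n I i"
      using Suc.hyps by (simp add: flat_index_def)
    ultimately have q: "flat_index n I i - 1 < dim_prod n I"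
      using Suc.IH by (metis (no_types, lifting) image_eqI lessThan_iff)
    have b: "1 \<le> i n" "1 \<le> i (Suc n)" "i (Suc n) \<le> I (Suc n)"
      using multi_indices_bounds[OF i(1), of n] multi_indices_bounds[OF i(1), of "Suc n"] Suc.hyps
      by auto
    have "(flat_index n I i - 1) * I (Suc n) + I (Suc n) \<le> dim_prod n I * I (Suc n)"
      using mult_le_mono1[OF Suc_leI[OF q], of "I (Suc n)"] by simp
    then show "p \<in> {..<dim_prod (Suc n) I}"
      using b i(2) flat_index_Suc[where i = i and I = I, OF Suc.hyps b(1)] by (simp add: dim_prod_Suc)
  next
    fix p assume p: "p \<in> {..<dim_prod (Suc n) I}"
    then have pos: "0 < I (Suc n)" by (auto simp: dim_prod_Suc intro: gr0I)
    have "p div I (Suc n) < dim_prod n I"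
      using p by (simp add: dim_prod_Suc less_mult_imp_div_less)
    then obtain i where i: "i \<in> multi_indices n I" "flat_index n I i - 1 = p div I (Suc n)"
      using Suc.IH by (metis (no_types, lifting) imageE lessThan_iff)
    \<comment> \<open>Digits are 1-based, hence the successor of the remainder.\<close>
    let ?i = "i(Suc n := Suc (p mod I (Suc n)))"
    have "flat_index n I ?i = flat_index n I i" by (simp add: flat_index_def)
    moreover have "1 \<le> i n" using multi_indices_bounds[OF i(1), of n] Suc.hyps by simp
    ultimately have "flat_index (Suc n) I ?i - 1 = p"
      using flat_index_Suc[where i = ?i and I = I, OF Suc.hyps] i(2) by simp
    moreover have "?i \<in> multi_indices (Suc n) I"
      using i(1) pos by (auto simp: multi_indices_def PiE_iff extensional_def Suc_le_eq)
    ultimately show "p \<in> (\<lambda>i. flat_index (Suc n) I i - 1) ` multi_indices (Suc n) I"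
      by (metis (no_types, lifting) image_eqI)
  qed
qed

text \<open>A surjection between finite sets of equal size is injective; this replaces a separate
  proof that digits are unique.\<close>

lemma flat_index_bij:
  assumes "1 \<le> n"
  shows "bij_betw (\<lambda>i. flat_index n I i - 1) (multi_indices n I) {..<dim_prod n I}"
  unfolding bij_betw_def
  using flat_index_image[OF assms, of I] finite_multi_indices[of n I]
  by (auto intro!: eq_card_imp_inj_on simp: card_multi_indices)

lemma flat_index_less:
  "1 \<le> n \<Longrightarrow> i \<in> multi_indices n I \<Longrightarrow> flat_index n I i - 1 < dim_prod n I"
  using flat_index_image[of n I] by blast


section \<open>Contraction of a chain of matrices\<close>

text \<open>\<open>contract G r n v a\<close> is the entry \<open>a\<close> of the vector \<open>G\<^sub>1 \<cdots> G\<^sub>n v\<close>, evaluated from the right.\<close>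

primrec contract ::
    "(nat \<Rightarrow> nat \<Rightarrow> nat \<Rightarrow> real) \<Rightarrow> (nat \<Rightarrow> nat) \<Rightarrow> nat \<Rightarrow> (nat \<Rightarrow> real) \<Rightarrow> nat \<Rightarrow> real" where
  "contract G r 0 v = v"
| "contract G r (Suc n) v = contract G r n (\<lambda>a. \<Sum>b = 1..r (Suc n). G (Suc n) a b * v b)"

text \<open>A chain of matrices acts linearly on its vector. The vectors vary in the induction
  because each step replaces them by their products with the last matrix. This later moves the sum
  over the columns inside the row cores.\<close>

lemma contract_sum:
  "contract G r n (\<lambda>b. \<Sum>s\<in>S. v s b * x s) a = (\<Sum>s\<in>S. contract G r n (v s) a * x s)"
proof (induction n arbitrary: v)
  case (Suc n)
  have "(\<Sum>b = 1..r (Suc n). G (Suc n) a b * (\<Sum>s\<in>S. v s b * x s)) =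
        (\<Sum>s\<in>S. (\<Sum>b = 1..r (Suc n). G (Suc n) a b * v s b) * x s)" for a
    by (simp add: sum_distrib_left sum_distrib_right mult.assoc sum.swap[of _ S])
  then show ?case
    by (simp only: contract.simps Suc.IH)
qed simp

lemma contract_scale: "contract G r n (\<lambda>b. v b * x) a = contract G r n v a * x"
  using contract_sum[of G r n "\<lambda>_. v" "\<lambda>_. x" "{()}" a] by simp

text \<open>The new coordinate goes into the inner sum because \<open>contract\<close> eliminates
  the last index first.\<close>

lemma sum_PiE_insert:
  fixes f :: "('a \<Rightarrow> 'b) \<Rightarrow> real"
  assumes "k \<notin> S"
  shows "sum f (Pi\<^sub>E (insert k S) D) = (\<Sum>\<kappa>\<in>Pi\<^sub>E S D. \<Sum>b\<in>D k. f (\<kappa>(k := b)))"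
proof -
  have "sum f (Pi\<^sub>E (insert k S) D) = (\<Sum>(b, \<kappa>)\<in>D k \<times> Pi\<^sub>E S D. f (\<kappa>(k := b)))"
    unfolding PiE_insert_eq
    by (subst sum.reindex[OF inj_combinator[OF assms]]) (auto simp: o_def case_prod_beta)
  then show ?thesis
    by (simp add: sum.cartesian_product[symmetric] sum.swap[of _ "Pi\<^sub>E S D"])
qed

text \<open>Distributivity turns a sum over all index paths into successive matrix-vector products.
  The weight \<open>f\<close> at the left end allows a Kronecker delta to fix the first
  index.\<close>

lemma sum_chain:
  "(\<Sum>\<kappa>\<in>(\<Pi>\<^sub>E k\<in>{0..n}. {1..r k}). f (\<kappa> 0) * (\<Prod>k = 1..n. G k (\<kappa> (k - 1)) (\<kappa> k)) * v (\<kappa> n)) =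
   (\<Sum>a = 1..r 0. f a * contract G r n v a)"
proof (induction n arbitrary: v)
  case 0
  have "(\<Pi>\<^sub>E k\<in>{0..0}. {1..r k}) = (\<Pi>\<^sub>E k\<in>insert 0 {}. {1..r k})" by simp
  then show ?case by (simp only: sum_PiE_insert[OF empty_iff[THEN iffD1, THEN notI]]) simp
next
  case (Suc n)
  have ins: "{0..Suc n} = insert (Suc n) {0..n}" by auto
  \<comment> \<open>The first \<open>n\<close> factors read coordinates up to \<open>n\<close> only,
    so the update at \<open>Suc n\<close> leaves them unchanged.\<close>
  have "(\<Prod>k = 1..n. G k ((\<kappa>(Suc n := b)) (k - 1)) ((\<kappa>(Suc n := b)) k)) =
        (\<Prod>k = 1..n. G k (\<kappa> (k - 1)) (\<kappa> k))" for \<kappa> b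
    by (rule prod.cong) auto
  then show ?case
    unfolding ins contract.simps Suc.IH[symmetric]
    by (subst sum_PiE_insert) (simp_all add: sum_distrib_left mult.assoc)
qed


section \<open>Families of functions computed by straight-line programs\<close>

text \<open>
  A scalar computation is identified with the function of the input assignment that it evaluates,
  so that a cost bound for a set of such functions can be extended one operation at a time.
\<close>

definition available :: "'v set \<Rightarrow> 'v instr list \<Rightarrow> (('v \<Rightarrow> real) \<Rightarrow> real) \<Rightarrow> bool" where
  "available V p f \<longleftrightarrow>
     (\<exists>a. operand_ok V (length p) a \<and> (\<forall>\<rho>. operand_val \<rho> (results \<rho> p) a = f \<rho>))"

definition computable_within ::
    "'v set \<Rightarrow> (('v \<Rightarrow> real) \<Rightarrow> real) set \<Rightarrow> nat \<Rightarrow> bool" where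
  "computable_within V F c \<longleftrightarrow>
     (\<exists>p. (\<forall>t<length p. instr_ok V t (p ! t)) \<and> length p \<le> c \<and> (\<forall>f\<in>F. available V p f))"

lemma results_snoc: "results \<rho> (p @ [e]) = results \<rho> p @ [instr_val \<rho> (results \<rho> p) e]"
  by (simp add: results_def)

lemma length_results [simp]: "length (results \<rho> p) = length p"
  by (induction p rule: rev_induct) (simp_all add: results_snoc results_def[of _ "[]"])

text \<open>Appending an instruction leaves earlier results at their positions, so the same operand
  still works.\<close>

lemma available_snoc:
  assumes "available V p f"
  shows "available V (p @ [e]) f"
proof -
  obtain a where a: "operand_ok V (length p) a" "\<forall>\<rho>. operand_val \<rho> (results \<rho> p) a = f \<rho>"
    using assms by (auto simp: available_def)
  then show ?thesis
    unfolding available_def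
    by (intro exI[of _ a]) (cases a; auto simp: results_snoc nth_append)
qed

lemma available_last:
  assumes "\<And>\<rho>. instr_val \<rho> (results \<rho> p) e = f \<rho>"
  shows "available V (p @ [e]) f"
  unfolding available_def
  by (intro exI[of _ "Result (length p)"]) (simp add: results_snoc nth_append assms)

lemma computable_within_mono:
  "computable_within V F c \<Longrightarrow> F' \<subseteq> F \<Longrightarrow> c \<le> c' \<Longrightarrow> computable_within V F' c'"
  by (fastforce simp: computable_within_def)

lemma computable_within_inputs: "computable_within V {\<lambda>\<rho>. \<rho> v |v. v \<in> V} 0"
proof -
  have "available V [] (\<lambda>\<rho>. \<rho> v)" if "v \<in> V" for v
    unfolding available_def using that by (intro exI[of _ "Input v"]) simp
  then show ?thesis by (auto simp: computable_within_def)
qed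

lemma computable_within_instr:
  assumes "computable_within V F c" "f \<in> F" "g \<in> F"
  shows computable_within_add: "computable_within V (insert (\<lambda>\<rho>. f \<rho> + g \<rho>) F) (c + 1)"
    and computable_within_mul: "computable_within V (insert (\<lambda>\<rho>. f \<rho> * g \<rho>) F) (c + 1)"
proof -
  obtain p where p: "\<forall>t<length p. instr_ok V t (p ! t)" "length p \<le> c" "\<forall>f\<in>F. available V p f"
    using assms(1) by (auto simp: computable_within_def)
  obtain a b where
    ab: "operand_ok V (length p) a" "\<And>\<rho>. operand_val \<rho> (results \<rho> p) a = f \<rho>"
        "operand_ok V (length p) b" "\<And>\<rho>. operand_val \<rho> (results \<rho> p) b = g \<rho>"
    using p(3) assms(2,3) unfolding available_def by metis
  show "computable_within V (insert (\<lambda>\<rho>. f \<rho> + g \<rho>) F) (c + 1)"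
    unfolding computable_within_def
    by (intro exI[of _ "p @ [Add a b]"])
      (use p ab in \<open>auto simp: nth_append less_Suc_eq intro: available_snoc available_last\<close>)
  show "computable_within V (insert (\<lambda>\<rho>. f \<rho> * g \<rho>) F) (c + 1)"
    unfolding computable_within_def
    by (intro exI[of _ "p @ [Mul a b]"])
      (use p ab in \<open>auto simp: nth_append less_Suc_eq intro: available_snoc available_last\<close>)
qed

lemma computable_within_family:
  assumes "finite T" "computable_within V F c"
    and "\<And>F' c' t. computable_within V F' c' \<Longrightarrow> F \<subseteq> F' \<Longrightarrow> t \<in> T \<Longrightarrow>
           computable_within V (insert (h t) F') (c' + d)"
  shows "computable_within V (F \<union> h ` T) (c + card T * d)"
  using assms(1,3)
proof (induction T rule: finite_induct)
  case empty
  then show ?case using assms(2) by simp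
next
  case (insert t T)
  have "computable_within V (F \<union> h ` T) (c + card T * d)"
    by (rule insert.IH) (rule insert.prems; simp)
  from insert.prems[OF this, of t] insert.hyps show ?case
    by (simp add: add_ac)
qed

text \<open>One addition per element, with one to spare, avoids a truncated
  \<open>card S - 1\<close>. Non-emptiness matters: an empty sum would be the constant 0, and
  programs have no constants.\<close>

lemma computable_within_sum:
  assumes "finite S" "S \<noteq> {}" "computable_within V F c" "\<And>s. s \<in> S \<Longrightarrow> f s \<in> F"
  shows "computable_within V (insert (\<lambda>\<rho>. \<Sum>s\<in>S. f s \<rho>) F) (c + card S)"
  using assms(1,2,4)
proof (induction S rule: finite_ne_induct)
  case (singleton s)
  then show ?case using assms(3) by (auto simp: insert_absorb intro: computable_within_mono)
next
  case (insert s S)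
  let ?F = "insert (\<lambda>\<rho>. \<Sum>s\<in>S. f s \<rho>) F"
  have "computable_within V ?F (c + card S)" using insert by simp
  then have "computable_within V (insert (\<lambda>\<rho>. f s \<rho> + (\<Sum>s\<in>S. f s \<rho>)) ?F) (c + card S + 1)"
    using insert.prems by (intro computable_within_add) auto
  then show ?case
    by (rule computable_within_mono) (use insert.hyps in auto)
qed

lemma computable_within_sum_prod:
  assumes "finite S" "S \<noteq> {}" "computable_within V F c"
    and "\<And>s. s \<in> S \<Longrightarrow> f s \<in> F" "\<And>s. s \<in> S \<Longrightarrow> g s \<in> F"
  shows "computable_within V (insert (\<lambda>\<rho>. \<Sum>s\<in>S. f s \<rho> * g s \<rho>) F) (c + 2 * card S)"
proof -
  let ?h = "\<lambda>s \<rho>. f s \<rho> * g s \<rho>"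
  have "computable_within V (F \<union> ?h ` S) (c + card S * 1)"
  proof (rule computable_within_family[OF assms(1,3)])
    fix F' c' s
    assume "computable_within V F' c'" "F \<subseteq> F'" "s \<in> S"
    then show "computable_within V (insert (?h s) F') (c' + 1)"
      using assms(4,5) by (intro computable_within_mul) auto
  qed
  from computable_within_sum[OF assms(1,2) this, of ?h] show ?thesis
    by (rule computable_within_mono) auto
qed

text \<open>Each \<open>t\<close> in \<open>T\<close> labels a separate chain. Eliminating the index
  of range \<open>r k\<close> takes, for each of the \<open>r (k - 1)\<close> remaining entries, a
  dot product of length \<open>r k\<close>. The induction removes the last matrix first, so
  \<open>F\<close>, \<open>c\<close> and \<open>v\<close> have to vary.\<close>

lemma computable_within_contract:
  assumes "computable_within V F c" "finite T"
    and "\<And>k. k \<in> {1..n} \<Longrightarrow> 0 < r k"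
    and "\<And>t k a b. t \<in> T \<Longrightarrow> k \<in> {1..n} \<Longrightarrow> a \<in> {1..r (k - 1)} \<Longrightarrow> b \<in> {1..r k} \<Longrightarrow>
           (\<lambda>\<rho>. G \<rho> t k a b) \<in> F"
    and "\<And>t b. t \<in> T \<Longrightarrow> b \<in> {1..r n} \<Longrightarrow> (\<lambda>\<rho>. v \<rho> t b) \<in> F"
  shows "computable_within V
           (F \<union> (\<lambda>(t, a) \<rho>. contract (G \<rho> t) r n (v \<rho> t) a) ` (T \<times> {1..r 0}))
           (c + 2 * card T * (\<Sum>k = 1..n. r (k - 1) * r k))"
  using assms(1,3-)
proof (induction n arbitrary: F c v)
  case 0
  then show ?case by (auto intro: computable_within_mono)
next
  case (Suc n)
  let ?w = "\<lambda>\<rho> t a. \<Sum>b = 1..r (Suc n). G \<rho> t (Suc n) a b * v \<rho> t b"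
  let ?F = "F \<union> (\<lambda>(t, a) \<rho>. ?w \<rho> t a) ` (T \<times> {1..r n})"
  \<comment> \<open>Each of the \<open>r n\<close> entries per chain is a dot product of length
    \<open>r (Suc n)\<close>.\<close>
  let ?c = "c + card (T \<times> {1..r n}) * (2 * r (Suc n))"
  have r: "{1..r (Suc n)} \<noteq> {}" using Suc.prems(2)[of "Suc n"] by simp
  have "computable_within V (insert (\<lambda>\<rho>. ?w \<rho> t a) F') (c' + 2 * r (Suc n))"
    if "computable_within V F' c'" "F \<subseteq> F'" "t \<in> T" "a \<in> {1..r n}" for F' c' t a
    using computable_within_sum_prod[OF _ r that(1), of "\<lambda>b \<rho>. G \<rho> t (Suc n) a b" "\<lambda>b \<rho>. v \<rho> t b"]
      Suc.prems(3)[OF that(3), of "Suc n" a] Suc.prems(4)[OF that(3)] that by auto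
  then have "computable_within V ?F ?c"
    by (intro computable_within_family finite_cartesian_product assms(2) Suc.prems(1)) auto
  then have "computable_within V
      (?F \<union> (\<lambda>(t, a) \<rho>. contract (G \<rho> t) r n (?w \<rho> t) a) ` (T \<times> {1..r 0}))
      (?c + 2 * card T * (\<Sum>k = 1..n. r (k - 1) * r k))"
    by (rule Suc.IH) (use Suc.prems in auto)
  then show ?case
    by (rule computable_within_mono) (auto simp: card_cartesian_product algebra_simps)
qed

text \<open>Passes from functions back to programs. One operand per output label is chosen uniformly
  for all input assignments.\<close>

lemma computable_withinE:
  assumes "computable_within V F c" "\<And>u. u \<in> U \<Longrightarrow> h u \<in> F"
  obtains p out where "is_program V U p out" "length p \<le> c"
    "\<And>u \<rho>. u \<in> U \<Longrightarrow> output_val \<rho> p out u = h u \<rho>"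
proof -
  obtain p where p: "\<forall>t<length p. instr_ok V t (p ! t)" "length p \<le> c" "\<forall>f\<in>F. available V p f"
    using assms(1) by (auto simp: computable_within_def)
  have "\<forall>u\<in>U. \<exists>a. operand_ok V (length p) a \<and> (\<forall>\<rho>. operand_val \<rho> (results \<rho> p) a = h u \<rho>)"
    using p(3) assms(2) by (simp add: available_def)
  then obtain out where "\<forall>u\<in>U. operand_ok V (length p) (out u) \<and>
      (\<forall>\<rho>. operand_val \<rho> (results \<rho> p) (out u) = h u \<rho>)"
    by metis
  then show ?thesis
    using p by (intro that[of p out]) (auto simp: is_program_def output_val_def)
qed


section \<open>Tensor trains\<close>

text \<open>The gluing condition \<open>\<kappa> n = h 0\<close> is rewritten as a Kronecker delta.
  After exchanging the sums, the delta selects entry \<open>\<kappa> n\<close> of the column train,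
  which then serves as the vector for the row train.\<close>

lemma is_mps_contract:
  assumes "mps_shape n m I J r c" "is_mps n m I J r c A B W"
    and "i \<in> multi_indices n I" "j \<in> multi_indices m J"
  shows "W $$ (flat_index n I i - 1, flat_index m J j - 1) =
    contract (\<lambda>k a b. A (k, a, i k, b)) r n
      (contract (\<lambda>k a b. B (k, a, j k, b)) c m (\<lambda>_. 1)) 1"
proof -
  let ?A = "\<lambda>k a b. A (k, a, i k, b)" and ?B = "\<lambda>k a b. B (k, a, j k, b)"
  let ?K = "\<Pi>\<^sub>E k\<in>{0..n}. {1..r k}" and ?H = "\<Pi>\<^sub>E k\<in>{0..m}. {1..c k}"
  let ?PA = "\<lambda>\<kappa>. \<Prod>k = 1..n. ?A k (\<kappa> (k - 1)) (\<kappa> k)"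
  let ?PB = "\<lambda>h. \<Prod>k = 1..m. ?B k (h (k - 1)) (h k)"
  have shape: "r 0 = 1" "r n = c 0" using assms(1) by (auto simp: mps_shape_def)
  have fin: "finite ?K" by (intro finite_PiE) auto
  have B: "(\<Sum>h\<in>?H. (if h 0 = \<kappa> n then 1 else 0) * ?PB h) = contract ?B c m (\<lambda>_. 1) (\<kappa> n)"
    if "\<kappa> \<in> ?K" for \<kappa>
  proof -
    \<comment> \<open>The equality \<open>r n = c 0\<close> puts the selected index within the range
      of the column train, so the delta really picks a term.\<close>
    have "\<kappa> n \<in> {1..c 0}" using that shape by (auto dest: PiE_mem[of _ _ _ n])
    then show ?thesis
      using sum_chain[where f = "\<lambda>a. if a = \<kappa> n then 1 else 0" and G = ?B and v = "\<lambda>_. 1" and r = c and n = m]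
      by (simp add: if_distrib[of "\<lambda>x. x * _"] sum.delta cong: if_cong)
  qed
  have "W $$ (flat_index n I i - 1, flat_index m J j - 1) =
        (\<Sum>h\<in>?H. \<Sum>\<kappa>\<in>{\<kappa> \<in> ?K. \<kappa> n = h 0}. ?PA \<kappa> * ?PB h)"
    using assms(2-4) by (simp add: is_mps_def)
  also have "\<dots> = (\<Sum>h\<in>?H. \<Sum>\<kappa>\<in>?K. ?PA \<kappa> * ((if h 0 = \<kappa> n then 1 else 0) * ?PB h))"
    by (rule sum.cong[OF refl], subst sum.inter_filter[OF fin]) (auto intro!: sum.cong)
  also have "\<dots> = (\<Sum>\<kappa>\<in>?K. ?PA \<kappa> * (\<Sum>h\<in>?H. (if h 0 = \<kappa> n then 1 else 0) * ?PB h))"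
    by (subst sum.swap) (simp add: sum_distrib_left)
  also have "\<dots> = (\<Sum>\<kappa>\<in>?K. 1 * ?PA \<kappa> * contract ?B c m (\<lambda>_. 1) (\<kappa> n))"
    using B by (intro sum.cong) auto
  also have "\<dots> = contract ?A r n (contract ?B c m (\<lambda>_. 1)) 1"
    unfolding sum_chain[where f = "\<lambda>_. 1" and G = ?A] using shape by simp
  finally show ?thesis .
qed

text \<open>Linearity moves the sum over columns inside the row train, leaving a vector that does
  not depend on the row. This is why the cost has separate terms in the numbers of rows and columns
  rather than their product.\<close>

lemma is_mps_mult_vec:
  assumes "mps_shape n m I J r c" "is_mps n m I J r c A B W" "x \<in> carrier_vec (dim_prod m J)"
    and "i \<in> multi_indices n I"
  shows "(W *\<^sub>v x) $ (flat_index n I i - 1) =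
    contract (\<lambda>k a b. A (k, a, i k, b)) r n
      (\<lambda>b. \<Sum>j\<in>multi_indices m J.
         contract (\<lambda>k a b. B (k, a, j k, b)) c m (\<lambda>_. x $ (flat_index m J j - 1)) b) 1"
proof -
  let ?A = "\<lambda>k a b. A (k, a, i k, b)" and ?B = "\<lambda>j k a b. B (k, a, j k, b)"
  let ?x = "\<lambda>j. x $ (flat_index m J j - 1)"
  have nm: "1 \<le> n" "1 \<le> m" using assms(1) by (auto simp: mps_shape_def)
  have W: "W \<in> carrier_mat (dim_prod n I) (dim_prod m J)"
    using assms(2) by (simp add: is_mps_def)
  have p: "flat_index n I i - 1 < dim_prod n I" using flat_index_less[OF nm(1) assms(4)] .
  have "(W *\<^sub>v x) $ (flat_index n I i - 1) =
        (\<Sum>q\<in>{..<dim_prod m J}. W $$ (flat_index n I i - 1, q) * x $ q)"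
    using p W assms(3) by (auto simp: scalar_prod_def atLeast0LessThan intro!: sum.cong)
  also have "\<dots> = (\<Sum>j\<in>multi_indices m J.
                    W $$ (flat_index n I i - 1, flat_index m J j - 1) * ?x j)"
    by (rule sum.reindex_bij_betw[OF flat_index_bij[OF nm(2)], symmetric])
  also have "\<dots> = (\<Sum>j\<in>multi_indices m J.
                    contract ?A r n (contract (?B j) c m (\<lambda>_. 1)) 1 * ?x j)"
    by (intro sum.cong refl) (simp only: is_mps_contract[OF assms(1,2,4)])
  also have "\<dots> = contract ?A r n
      (\<lambda>b. \<Sum>j\<in>multi_indices m J. contract (?B j) c m (\<lambda>_. 1) b * ?x j) 1"
    by (rule contract_sum[symmetric])
  \<comment> \<open>The factor from \<open>x\<close> becomes the starting vector in place of the
    constant 1, which a program could not read.\<close>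
  also have "(\<lambda>b. \<Sum>j\<in>multi_indices m J. contract (?B j) c m (\<lambda>_. 1) b * ?x j) =
             (\<lambda>b. \<Sum>j\<in>multi_indices m J. contract (?B j) c m (\<lambda>_. ?x j) b)"
    by (intro ext sum.cong refl) (simp only: contract_scale[symmetric] mult_1_left)
  finally show ?thesis .
qed

text \<open>Since the last rank is 1, the last core is itself a column vector and can start the
  chain. Only the first \<open>n\<close> of the \<open>Suc n\<close> cores remain to be
  multiplied.\<close>

lemma is_mpo_contract:
  assumes "mpo_shape (Suc n) I J r" "is_mpo (Suc n) I J r A W"
    and "i \<in> multi_indices (Suc n) I" "j \<in> multi_indices (Suc n) J"
  shows "W $$ (flat_index (Suc n) I i - 1, flat_index (Suc n) J j - 1) =
    contract (\<lambda>k a b. A (k, a, i k + (j k - 1) * I k, b)) r n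
      (\<lambda>b. A (Suc n, b, i (Suc n) + (j (Suc n) - 1) * I (Suc n), 1)) 1"
proof -
  let ?A = "\<lambda>k a b. A (k, a, i k + (j k - 1) * I k, b)"
  have shape: "r 0 = 1" "r (Suc n) = 1" using assms(1) by (auto simp: mpo_shape_def)
  have "W $$ (flat_index (Suc n) I i - 1, flat_index (Suc n) J j - 1) =
        (\<Sum>\<kappa>\<in>(\<Pi>\<^sub>E k\<in>{0..Suc n}. {1..r k}).
          1 * (\<Prod>k = 1..Suc n. ?A k (\<kappa> (k - 1)) (\<kappa> k)) * 1)"
    using assms(2-4) by (simp add: is_mpo_def)
  also have "\<dots> = contract ?A r (Suc n) (\<lambda>_. 1) 1"
    unfolding sum_chain[where f = "\<lambda>_. 1" and G = ?A and v = "\<lambda>_. 1"] using shape by simp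
  finally show ?thesis using shape by simp
qed

section \<open>Core sizes and sums of products of neighbouring ranks\<close>

lemma card_core_entries:
  "card (core_entries n I r) = (\<Sum>k = 1..n. I k * (r (k - 1) * r k))"
  by (simp add: core_entries_def card_SigmaI card_cartesian_product mult_ac)

lemma card_core_entries_le:
  assumes "\<And>k. k \<in> {1..n} \<Longrightarrow> I k \<le> D"
  shows "card (core_entries n I r) \<le> D * (\<Sum>k = 1..n. r (k - 1) * r k)"
  unfolding card_core_entries sum_distrib_left
  by (intro sum_mono mult_le_mono1 assms)

lemma core_entries_iff:
  "(k, a, i, b) \<in> core_entries n I r \<longleftrightarrow>
     k \<in> {1..n} \<and> a \<in> {1..r (k - 1)} \<and> i \<in> {1..I k} \<and> b \<in> {1..r k}"
  by (simp add: core_entries_def)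

lemma dim_max_ge: "k \<in> {1..n} \<Longrightarrow> I k \<le> dim_max n I"
  by (simp add: dim_max_def)

lemma dim_prod_pos: "(\<And>k. k \<in> {1..n} \<Longrightarrow> 0 < I k) \<Longrightarrow> 0 < dim_prod n I"
  by (auto simp: dim_prod_def intro: prod_pos)

text \<open>The first product is just \<open>r 1\<close>, at most \<open>R\<close>; the other
  \<open>n - 1\<close> are at most \<open>R\<^sup>2\<close>. The right end is left free, so the
  bound covers the row train of an MPS and an MPO train without its last core.\<close>

lemma sum_rank_products_left:
  fixes r :: "nat \<Rightarrow> nat"
  assumes "\<And>k. k \<in> {0..n} \<Longrightarrow> r k \<le> R" "r 0 = 1" "1 \<le> n"
  shows "(\<Sum>k = 1..n. r (k - 1) * r k) \<le> R + (n - 1) * R\<^sup>2"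
proof -
  have "(\<Sum>k = 1..n. r (k - 1) * r k) = r 1 + (\<Sum>k = 2..n. r (k - 1) * r k)"
    using assms(2,3) by (simp add: sum.atLeast_Suc_atMost numeral_2_eq_2)
  also have "(\<Sum>k = 2..n. r (k - 1) * r k) \<le> (\<Sum>k = 2..n. R\<^sup>2)"
    unfolding power2_eq_square by (intro sum_mono mult_le_mono assms(1)) auto
  finally show ?thesis using assms(1)[of 1] assms(3) by simp
qed

text \<open>The mirror image, for the column train of an MPS: here the last product is the linear
  one.\<close>

lemma sum_rank_products_right:
  fixes r :: "nat \<Rightarrow> nat"
  assumes "\<And>k. k \<in> {0..n} \<Longrightarrow> r k \<le> R" "r n = 1" "1 \<le> n"
  shows "(\<Sum>k = 1..n. r (k - 1) * r k) \<le> R + (n - 1) * R\<^sup>2"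
proof -
  obtain l where n: "n = Suc l" using assms(3) by (cases n) auto
  have "(\<Sum>k = 1..l. r (k - 1) * r k) \<le> (\<Sum>k = 1..l. R\<^sup>2)"
    unfolding power2_eq_square by (intro sum_mono mult_le_mono assms(1)) (auto simp: n)
  then show ?thesis using assms(1)[of l] assms(2) by (simp add: n)
qed

lemma mps_rank_ge:
  "k \<in> {0..n} \<Longrightarrow> r k \<le> mps_rank n m r c" "k \<in> {0..m} \<Longrightarrow> c k \<le> mps_rank n m r c"
  by (simp_all add: mps_rank_def)

lemma mpo_rank_ge: "k \<in> {0..n} \<Longrightarrow> r k \<le> mpo_rank n r"
  by (simp add: mpo_rank_def)

section \<open>Storage and matrix-vector cost in MPS form\<close>

lemma mps_storage:
  assumes "mps_shape n m I J r c"
  defines "R \<equiv> mps_rank n m r c"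
  shows "card (mps_entries n m I J r c) \<le>
    dim_max n I * (R + (n - 1) * R\<^sup>2) + dim_max m J * (R + (m - 1) * R\<^sup>2)"
proof -
  have fin: "finite (core_entries n I r)" "finite (core_entries m J c)"
    by (auto simp: core_entries_def)
  have "(\<Sum>k = 1..n. r (k - 1) * r k) \<le> R + (n - 1) * R\<^sup>2"
       "(\<Sum>k = 1..m. c (k - 1) * c k) \<le> R + (m - 1) * R\<^sup>2"
    unfolding R_def using assms(1) mps_rank_ge
    by (intro sum_rank_products_left sum_rank_products_right; simp add: mps_shape_def)+
  moreover have "card (core_entries n I r) \<le> dim_max n I * (\<Sum>k = 1..n. r (k - 1) * r k)"
       "card (core_entries m J c) \<le> dim_max m J * (\<Sum>k = 1..m. c (k - 1) * c k)"
    by (rule card_core_entries_le, rule dim_max_ge, assumption)+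
  ultimately show ?thesis
    unfolding mps_entries_def card_Plus[OF fin]
    by (meson add_mono mult_le_mono2 order_trans)
qed

lemma mps_matvec:
  assumes shape: "mps_shape n m I J r c"
  defines "R \<equiv> mps_rank n m r c"
  shows "\<exists>p out. mps_matvec_program n m I J r c p out \<and>
    length p \<le> 3 * (dim_prod n I * (R + (n - 1) * R\<^sup>2) + dim_prod m J * (R + (m - 1) * R\<^sup>2))"
proof -
  let ?N = "dim_prod n I" and ?M = "dim_prod m J"
  let ?TI = "multi_indices n I" and ?TJ = "multi_indices m J"
  let ?V = "mps_entries n m I J r c <+> {..<?M}"
  define F0 where "F0 = {\<lambda>\<rho>::(label + label) + nat \<Rightarrow> real. \<rho> v |v. v \<in> ?V}"
  define A where "A = (\<lambda>(\<rho>::(label + label) + nat \<Rightarrow> real) i k a b. \<rho> (Inl (Inl (k, a, i k :: nat, b))))"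
  define B where "B = (\<lambda>(\<rho>::(label + label) + nat \<Rightarrow> real) j k a b. \<rho> (Inl (Inr (k, a, j k :: nat, b))))"
  \<comment> \<open>The starting vector has length \<open>c m = 1\<close>, so it may ignore the
    index \<open>b\<close>.\<close>
  define x where "x = (\<lambda>(\<rho>::(label + label) + nat \<Rightarrow> real) j (b::nat). \<rho> (Inr (flat_index m J j - 1)))"
  define y where "y = (\<lambda>\<rho> j. contract (B \<rho> j) c m (x \<rho> j))"
  define s where "s = (\<lambda>\<rho> b. \<Sum>j\<in>?TJ. y \<rho> j b)"
  have nm: "1 \<le> n" "1 \<le> m" and ends: "r 0 = 1" "c m = 1" "r n = c 0"
    and rpos: "\<And>k. k \<in> {1..n} \<Longrightarrow> 0 < r k" and cpos: "\<And>k. k \<in> {1..m} \<Longrightarrow> 0 < c k"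
    using shape by (auto simp: mps_shape_def)
  have Mpos: "0 < ?M" using shape by (auto simp: mps_shape_def intro!: dim_prod_pos)
  then have TJ: "?TJ \<noteq> {}" using card_multi_indices[of m J] by auto

  \<comment> \<open>First stage: all entries of every column train, started at the matching entry of
    the input vector.\<close>
  let ?F1 = "F0 \<union> (\<lambda>(j, b) \<rho>. y \<rho> j b) ` (?TJ \<times> {1..c 0})"
  let ?c1 = "0 + 2 * card ?TJ * (\<Sum>k = 1..m. c (k - 1) * c k)"
  have A_in: "(\<lambda>\<rho>. A \<rho> i k a b) \<in> F0"
    if "i \<in> ?TI" "k \<in> {1..n}" "a \<in> {1..r (k - 1)}" "b \<in> {1..r k}" for i k a b
    using that multi_indices_bounds[OF that(1,2)]
    unfolding F0_def A_def mps_entries_def by (fastforce simp: core_entries_iff)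
  have B_in: "(\<lambda>\<rho>. B \<rho> j k a b) \<in> F0"
    if "j \<in> ?TJ" "k \<in> {1..m}" "a \<in> {1..c (k - 1)}" "b \<in> {1..c k}" for j k a b
    using that multi_indices_bounds[OF that(1,2)]
    unfolding F0_def B_def mps_entries_def by (fastforce simp: core_entries_iff)
  have x_in: "(\<lambda>\<rho>. x \<rho> j b) \<in> F0" if "j \<in> ?TJ" for j b
    using flat_index_less[OF nm(2) that] unfolding F0_def x_def by fastforce
  have F1: "computable_within ?V ?F1 ?c1"
    unfolding y_def
  proof (rule computable_within_contract)
    show "computable_within ?V F0 0" unfolding F0_def by (rule computable_within_inputs)
    show "(\<lambda>\<rho>. x \<rho> j b) \<in> F0" if "j \<in> ?TJ" for j b using that by (rule x_in)
  qed (fact finite_multi_indices cpos B_in)+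

  \<comment> \<open>Second stage: the column vectors are added up entrywise, in \<open>c 0\<close>
    sums of \<open>card ?TJ\<close> terms.\<close>
  let ?F2 = "?F1 \<union> (\<lambda>b \<rho>. s \<rho> b) ` {1..c 0}"
  let ?c2 = "?c1 + card {1..c 0} * card ?TJ"
  have "computable_within ?V (insert (\<lambda>\<rho>. s \<rho> b) F') (c' + card ?TJ)"
    if "computable_within ?V F' c'" "?F1 \<subseteq> F'" "b \<in> {1..c 0}" for F' c' b
    unfolding s_def
  proof (rule computable_within_sum[OF finite_multi_indices TJ that(1)])
    fix j assume "j \<in> ?TJ"
    then have "(\<lambda>\<rho>. y \<rho> j b) \<in> ?F1"
      using that(3) by (intro UnI2 image_eqI[of _ _ "(j, b)"]) auto
    then show "(\<lambda>\<rho>. y \<rho> j b) \<in> F'" using that(2) by blast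
  qed
  then have F2: "computable_within ?V ?F2 ?c2"
    by (intro computable_within_family F1) auto

  \<comment> \<open>Third stage: every row train is applied to the same vector \<open>s\<close>,
    whose length \<open>c 0\<close> equals \<open>r n\<close>.\<close>
  let ?F3 = "?F2 \<union> (\<lambda>(i, a) \<rho>. contract (A \<rho> i) r n (s \<rho>) a) ` (?TI \<times> {1..r 0})"
  let ?c3 = "?c2 + 2 * card ?TI * (\<Sum>k = 1..n. r (k - 1) * r k)"
  have F3: "computable_within ?V ?F3 ?c3"
  proof (rule computable_within_contract[OF F2 finite_multi_indices])
    show "(\<lambda>\<rho>. A \<rho> i k a b) \<in> ?F2"
      if "i \<in> ?TI" "k \<in> {1..n}" "a \<in> {1..r (k - 1)}" "b \<in> {1..r k}" for i k a b
      by (intro UnI1 A_in that)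
    show "(\<lambda>\<rho>. s \<rho> b) \<in> ?F2" if "b \<in> {1..r n}" for b
      using that ends(3) by (intro UnI2 image_eqI[of _ _ b]) auto
  qed (fact rpos)

  have bij: "bij_betw (\<lambda>i. flat_index n I i - 1) ?TI {..<?N}" by (rule flat_index_bij[OF nm(1)])
  \<comment> \<open>Outputs are labelled by positions but chains by multi-indices;
    \<open>idx\<close> translates. As \<open>r 0 = 1\<close>, the output is entry 1 of the
    chain.\<close>
  define idx where "idx = inv_into ?TI (\<lambda>i. flat_index n I i - 1)"
  have idx: "idx q \<in> ?TI" "flat_index n I (idx q) - 1 = q" if "q < ?N" for q
    using that bij bij_betw_inv_into_right[OF bij, of q]
      bij_betw_apply[OF bij_betw_inv_into[OF bij], of q]
    by (auto simp: idx_def)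
  have mem: "(\<lambda>\<rho>. contract (A \<rho> (idx q)) r n (s \<rho>) 1) \<in> ?F3" if "q \<in> {..<?N}" for q
    using idx(1)[of q] that ends by (intro UnI2 image_eqI[of _ _ "(idx q, 1)"]) auto
  obtain p out where p: "is_program ?V {..<?N} p out" "length p \<le> ?c3"
    "\<And>q \<rho>. q \<in> {..<?N} \<Longrightarrow> output_val \<rho> p out q = contract (A \<rho> (idx q)) r n (s \<rho>) 1"
    by (rule computable_withinE[OF F3 mem], assumption, rule that, assumption, assumption, simp)
  have "vec ?N (output_val (case_sum (case_sum A' B') (($) x')) p out) = W *\<^sub>v x'"
    if W: "is_mps n m I J r c A' B' W" and x': "x' \<in> carrier_vec ?M" for A' B' W x'
  proof (rule eq_vecI)
    show "dim_vec (vec ?N (output_val (case_sum (case_sum A' B') (($) x')) p out)) =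
          dim_vec (W *\<^sub>v x')"
      using W by (auto simp: is_mps_def)
    fix q assume "q < dim_vec (W *\<^sub>v x')"
    then have q: "q < ?N" using W by (auto simp: is_mps_def)
    show "vec ?N (output_val (case_sum (case_sum A' B') (($) x')) p out) $ q = (W *\<^sub>v x') $ q"
      using is_mps_mult_vec[OF shape W x' idx(1)[OF q], unfolded idx(2)[OF q]] q
      by (simp add: p(3) A_def s_def y_def B_def x_def)
  qed
  then have "mps_matvec_program n m I J r c p out"
    using p(1) by (simp add: mps_matvec_program_def)
  \<comment> \<open>The trains cost twice their rank sums. Adding the column vectors costs
    \<open>c 0 * ?M\<close>, and \<open>c 0 \<le> R\<close> fits this into a third copy of the
    \<open>?M\<close> term.\<close>
  moreover have "length p \<le>
      3 * (?N * (R + (n - 1) * R\<^sup>2) + ?M * (R + (m - 1) * R\<^sup>2))"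
  proof -
    have "(\<Sum>k = 1..n. r (k - 1) * r k) \<le> R + (n - 1) * R\<^sup>2"
         "(\<Sum>k = 1..m. c (k - 1) * c k) \<le> R + (m - 1) * R\<^sup>2"
      unfolding R_def using nm ends mps_rank_ge
      by (intro sum_rank_products_left sum_rank_products_right; simp)+
    then have "?N * (\<Sum>k = 1..n. r (k - 1) * r k) \<le> ?N * (R + (n - 1) * R\<^sup>2)"
         "?M * (\<Sum>k = 1..m. c (k - 1) * c k) \<le> ?M * (R + (m - 1) * R\<^sup>2)"
      by (simp_all only: mult_le_mono2)
    moreover have "?M * c 0 \<le> ?M * (R + (m - 1) * R\<^sup>2)"
      using mps_rank_ge(2)[of 0 m c n r] by (intro mult_le_mono2) (simp add: R_def)
    ultimately show ?thesis
      using p(2) by (simp add: card_multi_indices algebra_simps)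
  qed
  ultimately show ?thesis by blast
qed

section \<open>Storage and reconstruction cost in MPO form\<close>

lemma mpo_core_index:
  fixes i j :: nat
  assumes "1 \<le> i" "i \<le> a" "1 \<le> j" "j \<le> b"
  shows "i + (j - 1) * a \<in> {1..a * b}"
proof -
  obtain l where j: "j = Suc l" using assms(3) by (cases j) auto
  \<comment> \<open>The index is at most \<open>l * a + a\<close>, which is
    \<open>a * Suc l\<close>.\<close>
  have "a * Suc l \<le> a * b" using assms(4) j by (intro mult_le_mono2) simp
  then show ?thesis using assms by (simp add: j mult.commute)
qed

text \<open>Both end ranks are 1, so the first and the last rank product are each at most
  \<open>R\<close>. Splitting off the last core keeps this valid for \<open>n = 2\<close>, where no
  quadratic terms remain.\<close>

lemma mpo_storage:
  assumes "mpo_shape n I J r"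
  defines "R \<equiv> mpo_rank n r"
  shows "card (mpo_entries n I J r) \<le> dim_max n I * dim_max n J * (2 * R + (n - 2) * R\<^sup>2)"
proof -
  have "2 \<le> n" and ends: "r 0 = 1" "r n = 1" using assms(1) by (simp_all add: mpo_shape_def)
  then obtain l where n: "n = Suc l" "1 \<le> l" by (cases n) auto
  have "(\<Sum>k = 1..l. r (k - 1) * r k) \<le> R + (l - 1) * R\<^sup>2"
    using n ends mpo_rank_ge[of _ n r] by (intro sum_rank_products_left) (auto simp: R_def)
  moreover have "r l \<le> R" using mpo_rank_ge[of l n r] n by (simp add: R_def)
  ultimately have "(\<Sum>k = 1..n. r (k - 1) * r k) \<le> 2 * R + (n - 2) * R\<^sup>2"
    using n ends by simp
  moreover have "card (mpo_entries n I J r) \<le>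
      (dim_max n I * dim_max n J) * (\<Sum>k = 1..n. r (k - 1) * r k)"
    unfolding mpo_entries_def by (intro card_core_entries_le mult_le_mono dim_max_ge)
  ultimately show ?thesis by (meson mult_le_mono2 order_trans)
qed

text \<open>Every pair of a row and a column gets its own chain. The last core starts it, and the
  remaining \<open>n - 1\<close> rank products give one linear term and \<open>n - 2\<close>
  quadratic ones.\<close>

lemma mpo_reconstruct:
  assumes shape: "mpo_shape n I J r"
  defines "R \<equiv> mpo_rank n r"
  shows "\<exists>p out. mpo_reconstruct_program n I J r p out \<and>
    length p \<le> 2 * (dim_prod n I * dim_prod n J) * (R + (n - 2) * R\<^sup>2)"
proof -
  have "2 \<le> n" and ends: "r 0 = 1" "r n = 1" using shape by (simp_all add: mpo_shape_def)
  then obtain l where n: "n = Suc l" "1 \<le> l" by (cases n) auto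
  let ?N = "dim_prod n I" and ?M = "dim_prod n J"
  let ?TI = "multi_indices n I" and ?TJ = "multi_indices n J"
  let ?V = "mpo_entries n I J r"
  define F0 where "F0 = {\<lambda>\<rho>::label \<Rightarrow> real. \<rho> v |v. v \<in> ?V}"
  define A where "A = (\<lambda>(\<rho>::label \<Rightarrow> real) (i, j) k a b. \<rho> (k, a, i k + (j k - 1) * I k, b))"
  have A_in: "(\<lambda>\<rho>. A \<rho> t k a b) \<in> F0"
    if "t \<in> ?TI \<times> ?TJ" "k \<in> {1..n}" "a \<in> {1..r (k - 1)}" "b \<in> {1..r k}" for t k a b
  proof -
    obtain i j where "t = (i, j)" by (cases t)
    with that(1) have t: "t = (i, j)" "i \<in> ?TI" "j \<in> ?TJ" by auto
    have "i k + (j k - 1) * I k \<in> {1..I k * J k}"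
      using multi_indices_bounds[OF t(2) that(2)] multi_indices_bounds[OF t(3) that(2)]
      by (intro mpo_core_index) auto
    then have "(k, a, i k + (j k - 1) * I k, b) \<in> ?V"
      using that by (simp add: mpo_entries_def core_entries_iff)
    then show ?thesis unfolding F0_def A_def t(1) by auto
  qed
  let ?F1 = "F0 \<union> (\<lambda>(t, a) \<rho>. contract (A \<rho> t) r l (\<lambda>b. A \<rho> t n b 1) a) `
                    ((?TI \<times> ?TJ) \<times> {1..r 0})"
  let ?c1 = "0 + 2 * card (?TI \<times> ?TJ) * (\<Sum>k = 1..l. r (k - 1) * r k)"
  have F1: "computable_within ?V ?F1 ?c1"
  proof (rule computable_within_contract)
    show "computable_within ?V F0 0" unfolding F0_def by (rule computable_within_inputs)
    show "finite (?TI \<times> ?TJ)" by (intro finite_cartesian_product finite_multi_indices)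
    show "0 < r k" if "k \<in> {1..l}" for k using that shape n by (auto simp: mpo_shape_def)
    show "(\<lambda>\<rho>. A \<rho> t k a b) \<in> F0"
      if "t \<in> ?TI \<times> ?TJ" "k \<in> {1..l}" "a \<in> {1..r (k - 1)}" "b \<in> {1..r k}" for t k a b
      using that n by (intro A_in) auto
    \<comment> \<open>The fixed last index 1 is a legitimate label because
      \<open>r n = 1\<close>.\<close>
    show "(\<lambda>\<rho>. A \<rho> t n b 1) \<in> F0" if "t \<in> ?TI \<times> ?TJ" "b \<in> {1..r l}" for t b
      using that n ends by (intro A_in) auto
  qed
  have n1: "1 \<le> n" using n by simp
  define idx where "idx = (\<lambda>I. inv_into (multi_indices n I) (\<lambda>i. flat_index n I i - 1))"
  have idx: "idx I q \<in> multi_indices n I" "flat_index n I (idx I q) - 1 = q"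
    if "q < dim_prod n I" for q I
    using that flat_index_bij[OF n1, of I]
      bij_betw_inv_into_right[OF flat_index_bij[OF n1, of I], of q]
      bij_betw_apply[OF bij_betw_inv_into[OF flat_index_bij[OF n1, of I]], of q]
    by (auto simp: idx_def)
  let ?t = "\<lambda>u. (idx I (fst u), idx J (snd u))"
  have mem: "(\<lambda>\<rho>. contract (A \<rho> (?t u)) r l (\<lambda>b. A \<rho> (?t u) n b 1) 1) \<in> ?F1"
    if "u \<in> {..<?N} \<times> {..<?M}" for u
    using idx(1)[of "fst u" I] idx(1)[of "snd u" J] that ends
    by (intro UnI2 image_eqI[of _ _ "(?t u, 1)"]) auto
  obtain p out where p: "is_program ?V ({..<?N} \<times> {..<?M}) p out" "length p \<le> ?c1"
    "\<And>u \<rho>. u \<in> {..<?N} \<times> {..<?M} \<Longrightarrow>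
       output_val \<rho> p out u = contract (A \<rho> (?t u)) r l (\<lambda>b. A \<rho> (?t u) n b 1) 1"
    by (rule computable_withinE[OF F1 mem], assumption, rule that, assumption, assumption, simp)
  have "mat ?N ?M (output_val A' p out) = W" if W: "is_mpo n I J r A' W" for A' W
  proof (rule eq_matI)
    have dim: "dim_row W = ?N" "dim_col W = ?M" using W by (auto simp: is_mpo_def)
    show "dim_row (mat ?N ?M (output_val A' p out)) = dim_row W"
         "dim_col (mat ?N ?M (output_val A' p out)) = dim_col W"
      using dim by simp_all
    fix q q' assume "q < dim_row W" "q' < dim_col W"
    then have q: "q < ?N" "q' < ?M" using dim by auto
    show "mat ?N ?M (output_val A' p out) $$ (q, q') = W $$ (q, q')"
      using is_mpo_contract[OF shape[unfolded n(1)] W[unfolded n(1)], folded n(1),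
          OF idx(1)[OF q(1)] idx(1)[OF q(2)], unfolded idx(2)[OF q(1)] idx(2)[OF q(2)]] q
      by (simp add: p(3) A_def)
  qed
  then have "mpo_reconstruct_program n I J r p out"
    using p(1) by (simp add: mpo_reconstruct_program_def)
  moreover have "length p \<le> 2 * (?N * ?M) * (R + (n - 2) * R\<^sup>2)"
  proof -
    have "(\<Sum>k = 1..l. r (k - 1) * r k) \<le> R + (l - 1) * R\<^sup>2"
      using n ends mpo_rank_ge[of _ n r] by (intro sum_rank_products_left) (auto simp: R_def)
    then have "2 * (?N * ?M) * (\<Sum>k = 1..l. r (k - 1) * r k) \<le>
        2 * (?N * ?M) * (R + (n - 2) * R\<^sup>2)"
      using n by (intro mult_le_mono2) simp
    then show ?thesis
      using p(2) unfolding card_cartesian_product card_multi_indices by linarith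
  qed
  ultimately show ?thesis by blast
qed

text \<open>One dot product per row, at cost \<open>2 * M\<close>. Positivity of \<open>M\<close>
  excludes empty sums, whose value 0 a program cannot produce.\<close>

lemma dense_matvec:
  assumes "0 < M"
  shows "\<exists>p out. matvec_program N M p out \<and> length p \<le> 2 * (N * M)"
proof -
  let ?V = "({..<N} \<times> {..<M}) <+> {..<M}"
  define F where "F = {\<lambda>\<rho>::(nat \<times> nat) + nat \<Rightarrow> real. \<rho> v |v. v \<in> ?V}"
  define h where "h = (\<lambda>i (\<rho>::(nat \<times> nat) + nat \<Rightarrow> real). \<Sum>j<M. \<rho> (Inl (i, j)) * \<rho> (Inr j))"
  have "computable_within ?V (insert (h i) F') (c' + 2 * M)"
    if "computable_within ?V F' c'" "F \<subseteq> F'" "i \<in> {..<N}" for F' c' i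
  proof -
    have in_F: "(\<lambda>\<rho>. \<rho> v) \<in> F'" if "v \<in> ?V" for v using that \<open>F \<subseteq> F'\<close> by (auto simp: F_def)
    have "computable_within ?V (insert (h i) F') (c' + 2 * card {..<M})"
      unfolding h_def
      by (rule computable_within_sum_prod[OF _ _ that(1)])
        (use assms that(3) in \<open>auto intro!: in_F\<close>)
    then show ?thesis by simp
  qed
  then have "computable_within ?V (F \<union> h ` {..<N}) (0 + card {..<N} * (2 * M))"
    by (intro computable_within_family) (auto simp: F_def computable_within_inputs)
  from computable_withinE[OF this, of "{..<N}" h]
  obtain p out where p: "is_program ?V {..<N} p out" "length p \<le> N * (2 * M)"
    "\<And>i \<rho>. i \<in> {..<N} \<Longrightarrow> output_val \<rho> p out i = h i \<rho>"
    by auto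
  have "vec N (output_val (case_sum (($$) W) (($) x)) p out) = W *\<^sub>v x"
    if "W \<in> carrier_mat N M" "x \<in> carrier_vec M" for W x
    using that by (intro eq_vecI)
      (auto simp: p(3) h_def scalar_prod_def atLeast0LessThan intro!: sum.cong)
  then show ?thesis
    using p by (intro exI[of _ p] exI[of _ out]) (simp add: matvec_program_def)
qed

section \<open>The four bounds with explicit constants\<close>

theorem theorem1:
  shows
    "(\<exists>C::real. 0 < C \<and> (\<forall>n m I J r c. mps_shape n m I J r c \<longrightarrow>
       (let I' = real (dim_max n I); J' = real (dim_max m J); R = real (mps_rank n m r c) in
        real (card (mps_entries n m I J r c)) \<le>
          C * (R * (I' + J') + R\<^sup>2 * ((real n - 1) * I' + (real m - 1) * J'))))) \<and>
     (\<exists>C::real. 0 < C \<and> (\<forall>n m I J r c. mps_shape n m I J r c \<longrightarrow>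
       (let N = real (dim_prod n I); M = real (dim_prod m J); R = real (mps_rank n m r c) in
        \<exists>p out. mps_matvec_program n m I J r c p out \<and>
          real (length p) \<le> C * (R * (N + M) + R\<^sup>2 * ((real n - 1) * N + (real m - 1) * M))))) \<and>
     (\<exists>C::real. 0 < C \<and> (\<forall>n I J r. mpo_shape n I J r \<longrightarrow>
       (let I' = real (dim_max n I); J' = real (dim_max n J); R = real (mpo_rank n r) in
        real (card (mpo_entries n I J r)) \<le> C * (I' * J' * (2 * R + (real n - 2) * R\<^sup>2))))) \<and>
     (\<exists>C::real. 0 < C \<and> (\<forall>n I J r. mpo_shape n I J r \<longrightarrow>
       (let N = dim_prod n I; M = dim_prod n J; R = real (mpo_rank n r) in
        \<exists>p out q out'. mpo_reconstruct_program n I J r p out \<and> matvec_program N M q out' \<and>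
          real (length p + length q) \<le>
            C * (real N * real M * (R + R\<^sup>2 * (real n - 2))))))"
proof (intro conjI)
  show "\<exists>C::real. 0 < C \<and> (\<forall>n m I J r c. mps_shape n m I J r c \<longrightarrow>
       (let I' = real (dim_max n I); J' = real (dim_max m J); R = real (mps_rank n m r c) in
        real (card (mps_entries n m I J r c)) \<le>
          C * (R * (I' + J') + R\<^sup>2 * ((real n - 1) * I' + (real m - 1) * J'))))"
  proof (intro exI[of _ 1] conjI allI impI)
    fix n m I J r c assume shape: "mps_shape n m I J r c"
    \<comment> \<open>Writing \<open>n\<close> and \<open>m\<close> as successors reconciles the
      truncated \<open>n - 1\<close> and \<open>m - 1\<close> with the real differences.\<close>
    then obtain a b where "n = Suc a" "m = Suc b" by (cases n; cases m) (auto simp: mps_shape_def)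
    with mps_storage[OF shape, THEN of_nat_mono[where 'a = real]]
    show "let I' = real (dim_max n I); J' = real (dim_max m J); R = real (mps_rank n m r c) in
        real (card (mps_entries n m I J r c)) \<le>
          1 * (R * (I' + J') + R\<^sup>2 * ((real n - 1) * I' + (real m - 1) * J'))"
      by (simp add: Let_def algebra_simps)
  qed simp
  show "\<exists>C::real. 0 < C \<and> (\<forall>n m I J r c. mps_shape n m I J r c \<longrightarrow>
       (let N = real (dim_prod n I); M = real (dim_prod m J); R = real (mps_rank n m r c) in
        \<exists>p out. mps_matvec_program n m I J r c p out \<and>
          real (length p) \<le> C * (R * (N + M) + R\<^sup>2 * ((real n - 1) * N + (real m - 1) * M))))"
  proof (intro exI[of _ 3] conjI allI impI)
    fix n m I J r c assume shape: "mps_shape n m I J r c"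
    then obtain a b where "n = Suc a" "m = Suc b" by (cases n; cases m) (auto simp: mps_shape_def)
    moreover obtain p out where p: "mps_matvec_program n m I J r c p out" and
      "length p \<le> 3 * (dim_prod n I * (mps_rank n m r c + (n - 1) * (mps_rank n m r c)\<^sup>2) +
                       dim_prod m J * (mps_rank n m r c + (m - 1) * (mps_rank n m r c)\<^sup>2))"
      using mps_matvec[OF shape] by blast
    note this(2)[THEN of_nat_mono[where 'a = real]]
    ultimately show "let N = real (dim_prod n I); M = real (dim_prod m J);
          R = real (mps_rank n m r c) in
        \<exists>p out. mps_matvec_program n m I J r c p out \<and>
          real (length p) \<le> 3 * (R * (N + M) + R\<^sup>2 * ((real n - 1) * N + (real m - 1) * M))"
      unfolding Let_def
      by (intro exI[of _ p] exI[of _ out] conjI p) (simp add: algebra_simps)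
  qed simp
  show "\<exists>C::real. 0 < C \<and> (\<forall>n I J r. mpo_shape n I J r \<longrightarrow>
       (let I' = real (dim_max n I); J' = real (dim_max n J); R = real (mpo_rank n r) in
        real (card (mpo_entries n I J r)) \<le> C * (I' * J' * (2 * R + (real n - 2) * R\<^sup>2))))"
  proof (intro exI[of _ 1] conjI allI impI)
    fix n I J r assume shape: "mpo_shape n I J r"
    then have "2 \<le> n" by (simp add: mpo_shape_def)
    with mpo_storage[OF shape, THEN of_nat_mono[where 'a = real]]
    show "let I' = real (dim_max n I); J' = real (dim_max n J); R = real (mpo_rank n r) in
        real (card (mpo_entries n I J r)) \<le> 1 * (I' * J' * (2 * R + (real n - 2) * R\<^sup>2))"
      by (simp add: Let_def of_nat_diff)
  qed simp
  show "\<exists>C::real. 0 < C \<and> (\<forall>n I J r. mpo_shape n I J r \<longrightarrow>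
       (let N = dim_prod n I; M = dim_prod n J; R = real (mpo_rank n r) in
        \<exists>p out q out'. mpo_reconstruct_program n I J r p out \<and> matvec_program N M q out' \<and>
          real (length p + length q) \<le>
            C * (real N * real M * (R + R\<^sup>2 * (real n - 2)))))"
  \<comment> \<open>The constant is 2 for the reconstruction plus 2 for the multiplication.\<close>
  proof (intro exI[of _ 4] conjI allI impI)
    fix n I J r assume shape: "mpo_shape n I J r"
    let ?N = "dim_prod n I" and ?M = "dim_prod n J" and ?R = "mpo_rank n r"
    have n: "2 \<le> n" and M: "0 < ?M" and "r 0 = 1"
      using shape by (auto simp: mpo_shape_def intro!: dim_prod_pos)
    \<comment> \<open>The rank \<open>r 0 = 1\<close> gives \<open>?R\<close> at least 1, so the
      \<open>2 * (?N * ?M)\<close> operations of the multiplication are absorbed into the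
      reconstruction bound.\<close>
    then have "1 \<le> ?R" using mpo_rank_ge[of 0 n r] by simp
    then have "?N * ?M * 1 \<le> ?N * ?M * (?R + (n - 2) * ?R\<^sup>2)"
      by (intro mult_le_mono2) simp
    moreover obtain p out where p: "mpo_reconstruct_program n I J r p out" and
      "length p \<le> 2 * (?N * ?M) * (?R + (n - 2) * ?R\<^sup>2)"
      using mpo_reconstruct[OF shape] by blast
    moreover obtain q out' where q: "matvec_program ?N ?M q out'" and
      "length q \<le> 2 * (?N * ?M)"
      using dense_matvec[OF M] by blast
    ultimately have "length p + length q \<le> 4 * (?N * ?M * (?R + (n - 2) * ?R\<^sup>2))"
      unfolding mult.assoc mult_1_right by linarith
    from this[THEN of_nat_mono[where 'a = real]] n
    show "let N = ?N; M = ?M; R = real ?R in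
        \<exists>p out q out'. mpo_reconstruct_program n I J r p out \<and> matvec_program N M q out' \<and>
          real (length p + length q) \<le> 4 * (real N * real M * (R + R\<^sup>2 * (real n - 2)))"
      unfolding Let_def
      by (intro exI[of _ p] exI[of _ out] exI[of _ q] exI[of _ out'] conjI p q)
        (simp add: of_nat_diff mult.commute)
  qed simp
qed

end
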